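(* There exist polynomial time algorithms that, given an instance of the submodular search game SUB, compute $2$-optimal mixed strategies for both players (the Hider and the Searcher).
   Context: The game SUB (submodular search game): an instance consists of a finite set $[n]=\{1,\ldots,n\}$ of locations and a non-decreasing submodular set function $f:2^{[n]}\to\mathbb{R}^+$ (the cost of searching subsets), i.e. $f(A)\le f(B)$ whenever $A\subseteq B$ and $f(A\cup B)+f(A\cap B)\le f(A)+f(B)$ for all $A,B\subseteq[n]$. The values $f(S)$ for non-empty $S$ are positive integers, and $f$ can be evaluated in time polynomial in $n$ (value oracle). A pure strategy for the Hider (the maximizer) is a location $j\in[n]$. A pure strategy for the Searcher (the minimizer) is a permutation $\pi:[n]\to[n]$ ($\pi(i)$ being the $i$th location to be searched). The payoff is the cost of the set of locations searched up to and including $j$: $$C(j,\pi)=f(\{\pi(i): i\le \pi^{-1}(j)\}),$$ extended to mixed strategies by expectation. Let $V^*$ be the value of the zero-sum game. A mixed strategy $\hat{\mathbf{x}}$ of the Hider is $\alpha$-optimal if $C(\hat{\mathbf{x}},\mathbf{y})\ge V^*/\alpha$ for every Searcher mixed strategy $\mathbf{y}$; a mixed strategy $\hat{\mathbf{y}}$ of the Searcher is $\alpha$-optimal if $C(\mathbf{x},\hat{\mathbf{y}})\le \alpha V^*$ for every Hider mixed strategy $\mathbf{x}$. Polynomial time means time polynomial in $n$ and the logarithm of the largest payoff. Mixed strategies are output in sparse form (a list of the non-zero entries with their indices). *)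

theory Defs
  imports
    "HOL-Probability.Probability_Mass_Function"
    "HOL-Combinatorics.Permutations"
    "HOL-Library.Nat_Bijection"
    "HOL-Library.Log_Nat"
begin

section \<open>The submodular search game\<close>

text \<open>The value at the empty set is only required to be a non-negative real; no payoff depends
  on it.  Outside the subsets of \<open>{1..n}\<close> the function is unconstrained.\<close>

definition sub_instance :: "nat \<Rightarrow> (nat set \<Rightarrow> real) \<Rightarrow> bool" where
  "sub_instance n f \<longleftrightarrow>
     n \<ge> 1 \<and>
     (\<forall>S. S \<subseteq> {1..n} \<longrightarrow> 0 \<le> f S) \<and>
     (\<forall>S. S \<subseteq> {1..n} \<longrightarrow> S \<noteq> {} \<longrightarrow> f S \<in> \<nat> \<and> 0 < f S) \<and>
     (\<forall>A B. A \<subseteq> B \<longrightarrow> B \<subseteq> {1..n} \<longrightarrow> f A \<le> f B) \<and>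
     (\<forall>A B. A \<subseteq> {1..n} \<longrightarrow> B \<subseteq> {1..n} \<longrightarrow> f (A \<union> B) + f (A \<inter> B) \<le> f A + f B)"

definition payoff :: "(nat set \<Rightarrow> real) \<Rightarrow> nat \<Rightarrow> (nat \<Rightarrow> nat) \<Rightarrow> real" where
  "payoff f j \<pi> = f (\<pi> ` {1..inv \<pi> j})"

definition largest_payoff :: "nat \<Rightarrow> (nat set \<Rightarrow> real) \<Rightarrow> real" where
  "largest_payoff n f =
     Max ((\<lambda>(j, \<pi>). payoff f j \<pi>) ` ({1..n} \<times> {\<pi>. \<pi> permutes {1..n}}))"

definition hider_mixed :: "nat \<Rightarrow> nat pmf set" where
  "hider_mixed n = {x. set_pmf x \<subseteq> {1..n}}"

definition searcher_mixed :: "nat \<Rightarrow> (nat \<Rightarrow> nat) pmf set" where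
  "searcher_mixed n = {y. set_pmf y \<subseteq> {\<pi>. \<pi> permutes {1..n}}}"

definition expected_payoff :: "(nat set \<Rightarrow> real) \<Rightarrow> nat pmf \<Rightarrow> (nat \<Rightarrow> nat) pmf \<Rightarrow> real" where
  "expected_payoff f x y =
     measure_pmf.expectation (pair_pmf x y) (\<lambda>(j, \<pi>). payoff f j \<pi>)"

text \<open>Both players have finitely many pure strategies, so by the minimax theorem this equals the
  corresponding infimum of suprema.\<close>

definition game_value :: "nat \<Rightarrow> (nat set \<Rightarrow> real) \<Rightarrow> real" where
  "game_value n f = (SUP x\<in>hider_mixed n. INF y\<in>searcher_mixed n. expected_payoff f x y)"

definition hider_optimal :: "real \<Rightarrow> nat \<Rightarrow> (nat set \<Rightarrow> real) \<Rightarrow> nat pmf \<Rightarrow> bool" where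
  "hider_optimal \<alpha> n f x \<longleftrightarrow>
     x \<in> hider_mixed n \<and>
     (\<forall>y\<in>searcher_mixed n. expected_payoff f x y \<ge> game_value n f / \<alpha>)"

definition searcher_optimal ::
  "real \<Rightarrow> nat \<Rightarrow> (nat set \<Rightarrow> real) \<Rightarrow> (nat \<Rightarrow> nat) pmf \<Rightarrow> bool" where
  "searcher_optimal \<alpha> n f y \<longleftrightarrow>
     y \<in> searcher_mixed n \<and>
     (\<forall>x\<in>hider_mixed n. expected_payoff f x y \<le> \<alpha> * game_value n f)"


section \<open>Sparse output of mixed strategies\<close>

text \<open>An entry \<open>(s, a, b)\<close> says that the pure strategy \<open>s\<close> has the non-zero probability \<open>a / b\<close>.\<close>

definition sparse_form :: "('a \<times> nat \<times> nat) list \<Rightarrow> 'a pmf \<Rightarrow> bool" where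
  "sparse_form es p \<longleftrightarrow>
     distinct (map fst es) \<and>
     fst ` set es = set_pmf p \<and>
     (\<forall>(s, a, b)\<in>set es. b > 0 \<and> pmf p s = real a / real b)"

definition hider_output :: "nat pmf \<Rightarrow> nat list \<Rightarrow> bool" where
  "hider_output x w \<longleftrightarrow>
     (\<exists>es. sparse_form es x \<and> w = concat (map (\<lambda>(j, a, b). [j, a, b]) es))"

definition searcher_output :: "nat \<Rightarrow> (nat \<Rightarrow> nat) pmf \<Rightarrow> nat list \<Rightarrow> bool" where
  "searcher_output n y w \<longleftrightarrow>
     (\<exists>es. sparse_form es y \<and>
           w = concat (map (\<lambda>(\<pi>, a, b). map \<pi> [1..<Suc n] @ [a, b]) es))"


section \<open>Random access machines with a value oracle, under logarithmic cost\<close>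

text \<open>Registers hold natural numbers and are addressed by natural numbers; \<open>Load\<close> and \<open>Store\<close>
  address indirectly, \<open>Sub\<close> is truncated subtraction.  A query set is passed as the number whose
  binary digits are its characteristic vector.  A machine stops when its program counter leaves
  the program.\<close>

datatype instr =
    Const nat nat
  | Add nat nat nat
  | Sub nat nat nat
  | Load nat nat
  | Store nat nat
  | Jump nat
  | JumpZero nat nat
  | Query nat nat
  | Write nat

type_synonym config = "nat \<times> (nat \<Rightarrow> nat) \<times> nat list"

fun exec :: "(nat set \<Rightarrow> nat) \<Rightarrow> instr \<Rightarrow> config \<Rightarrow> config" where
  "exec \<phi> (Const r k) (pc, m, out) = (Suc pc, m(r := k), out)"
| "exec \<phi> (Add r s t) (pc, m, out) = (Suc pc, m(r := m s + m t), out)"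
| "exec \<phi> (Sub r s t) (pc, m, out) = (Suc pc, m(r := m s - m t), out)"
| "exec \<phi> (Load r s) (pc, m, out) = (Suc pc, m(r := m (m s)), out)"
| "exec \<phi> (Store r s) (pc, m, out) = (Suc pc, m(m r := m s), out)"
| "exec \<phi> (Jump l) (pc, m, out) = (l, m, out)"
| "exec \<phi> (JumpZero r l) (pc, m, out) = (if m r = 0 then l else Suc pc, m, out)"
| "exec \<phi> (Query r s) (pc, m, out) = (Suc pc, m(r := \<phi> (set_decode (m s))), out)"
| "exec \<phi> (Write r) (pc, m, out) = (Suc pc, m, out @ [m r])"

definition len :: "nat \<Rightarrow> nat" where
  "len k = Suc (floorlog 2 k)"

text \<open>An instruction is charged for the lengths of the addresses and the numbers that it handles;
  a query of \<open>S\<close> is charged \<open>\<tau> S\<close> in addition.\<close>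

fun cost :: "(nat set \<Rightarrow> nat) \<Rightarrow> (nat set \<Rightarrow> nat) \<Rightarrow> instr \<Rightarrow> (nat \<Rightarrow> nat) \<Rightarrow> nat" where
  "cost \<phi> \<tau> (Const r k) m = len r + len k"
| "cost \<phi> \<tau> (Add r s t) m = len r + len s + len t + len (m s) + len (m t)"
| "cost \<phi> \<tau> (Sub r s t) m = len r + len s + len t + len (m s) + len (m t)"
| "cost \<phi> \<tau> (Load r s) m = len r + len s + len (m s) + len (m (m s))"
| "cost \<phi> \<tau> (Store r s) m = len r + len s + len (m r) + len (m s)"
| "cost \<phi> \<tau> (Jump l) m = len l"
| "cost \<phi> \<tau> (JumpZero r l) m = len r + len l + len (m r)"
| "cost \<phi> \<tau> (Query r s) m =
     len r + len s + len (m s) + len (\<phi> (set_decode (m s))) + \<tau> (set_decode (m s))"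
| "cost \<phi> \<tau> (Write r) m = len r + len (m r)"

text \<open>\<open>run P \<phi> \<tau> c w t\<close>: started in \<open>c\<close>, the program \<open>P\<close> stops with output \<open>w\<close> after time \<open>t\<close>.\<close>

inductive run ::
  "instr list \<Rightarrow> (nat set \<Rightarrow> nat) \<Rightarrow> (nat set \<Rightarrow> nat) \<Rightarrow> config \<Rightarrow> nat list \<Rightarrow> nat \<Rightarrow> bool"
  for P :: "instr list" and \<phi> \<tau> :: "nat set \<Rightarrow> nat" where
  halt: "length P \<le> pc \<Longrightarrow> run P \<phi> \<tau> (pc, m, out) out 0"
| step: "pc < length P \<Longrightarrow> run P \<phi> \<tau> (exec \<phi> (P ! pc) (pc, m, out)) w t \<Longrightarrow>
         run P \<phi> \<tau> (pc, m, out) w (cost \<phi> \<tau> (P ! pc) m + t)"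

definition initial_config :: "nat \<Rightarrow> config" where
  "initial_config n = (0, (\<lambda>_. 0)(0 := n), [])"

text \<open>Among the subsets of \<open>{1..n}\<close>, rounding affects at most the empty set.\<close>

definition value_oracle :: "(nat set \<Rightarrow> real) \<Rightarrow> nat set \<Rightarrow> nat" where
  "value_oracle f S = nat \<lfloor>f S\<rfloor>"

text \<open>The relation \<open>R n f w\<close> specifies the acceptable outputs \<open>w\<close>.  Evaluating \<open>f\<close> may take any
  time \<open>\<tau>\<close> bounded by a polynomial \<open>a * n ^ b\<close>; the program may not depend on this polynomial,
  but the running time may.  As \<open>n \<ge> 1\<close> and payoffs are at least 1, every polynomial in \<open>n\<close>
  and in the logarithm of the largest payoff is dominated by a bound of the form used here.\<close>

definition poly_time_solves ::
  "instr list \<Rightarrow> (nat \<Rightarrow> (nat set \<Rightarrow> real) \<Rightarrow> nat list \<Rightarrow> bool) \<Rightarrow> bool" where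
  "poly_time_solves P R \<longleftrightarrow>
     (\<forall>a b :: nat. \<exists>c d :: nat. \<forall>n f \<tau>.
        sub_instance n f \<longrightarrow> (\<forall>S. S \<subseteq> {1..n} \<longrightarrow> \<tau> S \<le> a * n ^ b) \<longrightarrow>
        (\<exists>w t. run P (value_oracle f) \<tau> (initial_config n) w t \<and> R n f w \<and>
               real t \<le> real c * (real n + log 2 (largest_payoff n f)) ^ d))"

end

theory Submission
  imports Defs
begin

text \<open>Let \<open>F = f {1..n}\<close>.  No search costs more than \<open>F\<close>.  Conversely, the marginal values
  \<open>x j = f {1..j} - f {1..j-1}\<close> (with \<open>f {}\<close> replaced by 0) form a base of the polymatroid of \<open>f\<close>:
  they sum to \<open>F\<close> and \<open>x(A) \<le> f A\<close>.  If the Hider chooses \<open>j\<close> with probability \<open>x j / F\<close>,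
  then searching in the order \<open>\<pi>\<close> costs at least
  \<open>(\<Sum>i. x (\<pi> i) * (\<Sum>k\<le>i. x (\<pi> k))) / F \<ge> F / 2\<close>.  Hence the value lies between \<open>F / 2\<close> and \<open>F\<close>,
  this Hider strategy is 2-optimal, and so is every Searcher strategy, for example the
  identity permutation.\<close>

section \<open>The value of the game up to a factor of two\<close>

text \<open>Each mixed product occurs equally often on both sides, while each square occurs once on
  the left and twice on the right.\<close>

lemma square_sum_le_prefix_sums:
  fixes a :: "nat \<Rightarrow> real"
  shows "(\<Sum>i=1..n. a i)\<^sup>2 \<le> 2 * (\<Sum>i=1..n. a i * (\<Sum>k=1..i. a k))"
proof (induction n)
  case (Suc n)
  have "(\<Sum>i=1..Suc n. a i)\<^sup>2 =
      (\<Sum>i=1..n. a i)\<^sup>2 + 2 * (a (Suc n) * (\<Sum>i=1..n. a i)) + (a (Suc n))\<^sup>2"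
    by (simp add: power2_eq_square algebra_simps)
  moreover have "2 * (\<Sum>i=1..Suc n. a i * (\<Sum>k=1..i. a k)) =
      2 * (\<Sum>i=1..n. a i * (\<Sum>k=1..i. a k)) + 2 * (a (Suc n) * (\<Sum>i=1..n. a i))
      + 2 * (a (Suc n))\<^sup>2"
    by (simp add: power2_eq_square algebra_simps)
  ultimately show ?case
    using Suc.IH zero_le_power2[of "a (Suc n)"] by linarith
qed simp

section \<open>Expected payoffs as finite sums\<close>

lemma expected_payoff_eq_sum:
  assumes "x \<in> hider_mixed n" "y \<in> searcher_mixed n"
  shows "expected_payoff f x y =
    (\<Sum>\<pi>\<in>{\<pi>. \<pi> permutes {1..n}}. pmf y \<pi> * (\<Sum>j=1..n. pmf x j * payoff f j \<pi>))"
proof -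
  let ?S = "{\<pi>. \<pi> permutes {1..n}}"
  have fin: "finite ?S" by (simp add: finite_permutations)
  have "expected_payoff f x y =
      (\<Sum>p\<in>{1..n} \<times> ?S. pmf (pair_pmf x y) p * (case p of (j, \<pi>) \<Rightarrow> payoff f j \<pi>))"
    unfolding expected_payoff_def
    using assms fin
    by (subst integral_measure_pmf[where A = "{1..n} \<times> ?S"])
       (auto simp: hider_mixed_def searcher_mixed_def)
  also have "\<dots> = (\<Sum>j=1..n. \<Sum>\<pi>\<in>?S. pmf x j * pmf y \<pi> * payoff f j \<pi>)"
    unfolding sum.cartesian_product by (intro sum.cong) (auto simp: pmf_pair)
  also have "\<dots> = (\<Sum>\<pi>\<in>?S. \<Sum>j=1..n. pmf x j * pmf y \<pi> * payoff f j \<pi>)"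
    by (rule sum.swap)
  finally show ?thesis
    by (simp add: sum_distrib_left mult_ac)
qed

lemma sum_pmf_searcher:
  "y \<in> searcher_mixed n \<Longrightarrow> (\<Sum>\<pi>\<in>{\<pi>. \<pi> permutes {1..n}}. pmf y \<pi>) = 1"
  unfolding searcher_mixed_def by (rule sum_pmf_eq_1) (simp_all add: finite_permutations)

lemma sum_pmf_hider: "x \<in> hider_mixed n \<Longrightarrow> (\<Sum>j=1..n. pmf x j) = 1"
  by (rule sum_pmf_eq_1) (auto simp: hider_mixed_def)

text \<open>The value at 0 is not \<open>f {}\<close>, which may be positive.\<close>

definition prefix_value :: "(nat set \<Rightarrow> real) \<Rightarrow> nat \<Rightarrow> nat" where
  "prefix_value f j = (if j = 0 then 0 else value_oracle f {1..j})"

text \<open>The value is a natural number because the machine has to output it. By monotonicity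
  nothing is truncated for \<open>j \<le> n\<close>; at \<open>j = 0\<close> the result is
  0.\<close>

definition marginal :: "(nat set \<Rightarrow> real) \<Rightarrow> nat \<Rightarrow> nat" where
  "marginal f j = prefix_value f j - prefix_value f (j - 1)"

section \<open>Marginals as a base of the polymatroid\<close>

context
  fixes n :: nat and f :: "nat set \<Rightarrow> real"
  assumes inst: "sub_instance n f"
begin

lemmas inst_unfolded = inst[unfolded sub_instance_def]

lemmas n_pos = inst_unfolded[THEN conjunct1]
  and nonneg = inst_unfolded[THEN conjunct2, THEN conjunct1, rule_format]
  and Nats_pos = inst_unfolded[THEN conjunct2, THEN conjunct2, THEN conjunct1, rule_format]
  and monotone =
    inst_unfolded[THEN conjunct2, THEN conjunct2, THEN conjunct2, THEN conjunct1, rule_format]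
  and submodular =
    inst_unfolded[THEN conjunct2, THEN conjunct2, THEN conjunct2, THEN conjunct2, rule_format]

lemma total_pos: "0 < f {1..n}"
  using Nats_pos[of "{1..n}"] n_pos by simp

lemma of_nat_value_oracle:
  assumes "S \<subseteq> {1..n}" "S \<noteq> {}"
  shows "real (value_oracle f S) = f S"
proof -
  obtain k where "f S = real k"
    using Nats_pos[OF assms] by (auto elim: Nats_cases)
  then show ?thesis by (simp add: value_oracle_def)
qed

text \<open>Floors are monotone, so this covers the empty set too, although \<open>f {}\<close> may
  fail to be an integer.\<close>

lemma value_oracle_le_total: "S \<subseteq> {1..n} \<Longrightarrow> value_oracle f S \<le> value_oracle f {1..n}"
  unfolding value_oracle_def by (intro nat_mono floor_mono monotone) auto

lemma of_nat_total: "real (value_oracle f {1..n}) = f {1..n}"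
  using n_pos by (intro of_nat_value_oracle) auto

lemma value_oracle_total_ge_1: "1 \<le> value_oracle f {1..n}"
proof -
  have "0 < real (value_oracle f {1..n})"
    unfolding of_nat_total by (rule total_pos)
  then show ?thesis by simp
qed

lemma of_nat_prefix_value:
  "j \<le> n \<Longrightarrow> real (prefix_value f j) = (if j = 0 then 0 else f {1..j})"
  by (simp add: prefix_value_def of_nat_value_oracle)

lemma prefix_value_mono:
  assumes "i \<le> j" "j \<le> n"
  shows "prefix_value f i \<le> prefix_value f j"
proof -
  have "real (prefix_value f i) \<le> real (prefix_value f j)"
    using assms monotone[of "{1..i}" "{1..j}"] nonneg[of "{1..j}"]
    by (auto simp: of_nat_prefix_value)
  then show ?thesis by simp
qed

lemma of_nat_marginal:
  "j \<le> n \<Longrightarrow> real (marginal f j) = real (prefix_value f j) - real (prefix_value f (j - 1))"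
  using prefix_value_mono[of "j - 1" j] by (simp add: marginal_def)

lemma sum_marginal:
  assumes "m \<le> n"
  shows "(\<Sum>j=1..m. real (marginal f j)) = real (prefix_value f m)"
  using assms
proof (induction m)
  case 0
  show ?case by (simp add: prefix_value_def)
next
  case (Suc m)
  then show ?case by (simp add: of_nat_marginal)
qed

text \<open>Feasibility of the vertex that the greedy algorithm produces for a polymatroid. The
  induction removes the largest element of \<open>A\<close>; the empty set gets the bound 0, in line
  with \<open>prefix_value f 0\<close>.\<close>

lemma sum_marginal_le:
  assumes "A \<subseteq> {1..m}" "m \<le> n"
  shows "(\<Sum>j\<in>A. real (marginal f j)) \<le> (if A = {} then 0 else f A)"
  using assms
proof (induction m arbitrary: A)
  case (Suc m)
  show ?case
  proof (cases "Suc m \<in> A")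
    case False
    then have "A \<subseteq> {1..m}" using Suc.prems(1) by (auto simp: le_Suc_eq)
    then show ?thesis using Suc by auto
  next
    case True
    define A' where "A' = A - {Suc m}"
    have A': "A' \<subseteq> {1..m}" using Suc.prems(1) by (auto simp: A'_def le_Suc_eq)
    have A: "A = insert (Suc m) A'" using True by (auto simp: A'_def)
    have fin: "finite A'" using A' finite_subset by blast
    \<comment> \<open>Diminishing returns: adding \<open>Suc m\<close> to \<open>{1..m}\<close>
      gains at most what adding it to the smaller set \<open>A'\<close> gains.\<close>
    have "f (A \<union> {1..m}) + f (A \<inter> {1..m}) \<le> f A + f {1..m}"
      using Suc.prems by (intro submodular) auto
    moreover have "A \<union> {1..m} = {1..Suc m}" "A \<inter> {1..m} = A'"
      using A' by (auto simp: A)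
    ultimately have *: "f {1..Suc m} + f A' \<le> f A + f {1..m}" by simp
    have "(\<Sum>j\<in>A. real (marginal f j)) = real (marginal f (Suc m)) + (\<Sum>j\<in>A'. real (marginal f j))"
      unfolding A using fin by (subst sum.insert) (auto simp: A'_def)
    also have "(\<Sum>j\<in>A'. real (marginal f j)) \<le> (if A' = {} then 0 else f A')"
      using Suc A' by auto
    also have "real (marginal f (Suc m)) + (if A' = {} then 0 else f A') \<le> f A"
    \<comment> \<open>For \<open>m = 0\<close> the set \<open>A\<close> is \<open>{1}\<close>, and
      its marginal is all of \<open>f {1}\<close>, since 0 replaces \<open>f {}\<close>.\<close>
    proof (cases "m = 0")
      case True
      then show ?thesis using A' A Suc.prems by (auto simp: of_nat_marginal of_nat_prefix_value)
    next
      case False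
      \<comment> \<open>Serves the case \<open>A' = {}\<close>, where the non-negative
        \<open>f A'\<close> is dropped.\<close>
      have "f {1..Suc m} \<le> f A + f {1..m}"
        using * nonneg[of A'] A' Suc.prems(2) by fastforce
      then show ?thesis using * False Suc.prems by (auto simp: of_nat_marginal of_nat_prefix_value)
    qed
    finally show ?thesis using True by auto
  qed
qed simp

section \<open>Upper bounds on payoffs\<close>

lemma payoff_bounds:
  assumes "\<pi> permutes {1..n}" "j \<in> {1..n}"
  shows "0 \<le> payoff f j \<pi>" "payoff f j \<pi> \<le> f {1..n}"
proof -
  have "inv \<pi> j \<in> {1..n}" using assms permutes_in_image[OF permutes_inv[OF assms(1)]] by simp
  then have "\<pi> ` {1..inv \<pi> j} \<subseteq> \<pi> ` {1..n}" by (intro image_mono) auto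
  then have "\<pi> ` {1..inv \<pi> j} \<subseteq> {1..n}" by (simp only: permutes_image[OF assms(1)])
  then show "0 \<le> payoff f j \<pi>" "payoff f j \<pi> \<le> f {1..n}"
    unfolding payoff_def by (simp_all only: nonneg monotone order_refl)
qed

text \<open>The location searched last pays for the whole set. This turns the time bound into one in
  \<open>log 2 (f {1..n})\<close>.\<close>

lemma largest_payoff_eq: "largest_payoff n f = f {1..n}"
  unfolding largest_payoff_def
proof (rule Max_eqI)
  show "finite ((\<lambda>(j, \<pi>). payoff f j \<pi>) ` ({1..n} \<times> {\<pi>. \<pi> permutes {1..n}}))"
    by (simp add: finite_permutations)
  show "y \<le> f {1..n}"
    if "y \<in> (\<lambda>(j, \<pi>). payoff f j \<pi>) ` ({1..n} \<times> {\<pi>. \<pi> permutes {1..n}})" for y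
    using that payoff_bounds(2) by auto
  have "f {1..n} = (\<lambda>(j, \<pi>). payoff f j \<pi>) (n, id)" by (simp add: payoff_def)
  then show "f {1..n} \<in> (\<lambda>(j, \<pi>). payoff f j \<pi>) ` ({1..n} \<times> {\<pi>. \<pi> permutes {1..n}})"
    by (rule image_eqI) (use n_pos in \<open>auto simp: permutes_id\<close>)
qed

lemma expected_payoff_bounds:
  assumes x: "x \<in> hider_mixed n" and y: "y \<in> searcher_mixed n"
  shows "0 \<le> expected_payoff f x y" "expected_payoff f x y \<le> f {1..n}"
proof -
  show "0 \<le> expected_payoff f x y"
    unfolding expected_payoff_eq_sum[OF assms]
    by (intro sum_nonneg mult_nonneg_nonneg) (auto intro: payoff_bounds)
  have "expected_payoff f x y \<le>
      (\<Sum>\<pi>\<in>{\<pi>. \<pi> permutes {1..n}}. pmf y \<pi> * (\<Sum>j=1..n. pmf x j * f {1..n}))"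
    unfolding expected_payoff_eq_sum[OF assms]
    by (intro sum_mono mult_left_mono) (auto intro: payoff_bounds simp del: One_nat_def)
  also have "\<dots> = f {1..n}"
    by (simp add: sum_distrib_right[symmetric] sum_pmf_hider[OF x] sum_pmf_searcher[OF y]
             del: One_nat_def)
  finally show "expected_payoff f x y \<le> f {1..n}" .
qed

section \<open>The Hider strategy proportional to the marginals\<close>

definition greedy_hider :: "nat pmf" where
  "greedy_hider =
     embed_pmf (\<lambda>j. if j \<in> {1..n} then real (marginal f j) / f {1..n} else 0)"

lemma pmf_greedy_hider:
  "pmf greedy_hider j = (if j \<in> {1..n} then real (marginal f j) / f {1..n} else 0)"
  unfolding greedy_hider_def
proof (rule pmf_embed_pmf)
  show "0 \<le> (if j \<in> {1..n} then real (marginal f j) / f {1..n} else 0)" for j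
    using total_pos by simp
  have "(\<integral>\<^sup>+ j. ennreal (if j \<in> {1..n} then real (marginal f j) / f {1..n} else 0)
      \<partial>count_space UNIV) = (\<Sum>j=1..n. ennreal (real (marginal f j) / f {1..n}))"
    by (subst nn_integral_count_space'[where A = "{1..n}"]) auto
  also have "\<dots> = ennreal ((\<Sum>j=1..n. real (marginal f j)) / f {1..n})"
    using total_pos by (subst sum_ennreal) (auto simp: sum_divide_distrib)
  also have "(\<Sum>j=1..n. real (marginal f j)) = f {1..n}"
    using n_pos by (subst sum_marginal) (auto simp: of_nat_prefix_value)
  finally show "(\<integral>\<^sup>+ j. ennreal (if j \<in> {1..n} then real (marginal f j) / f {1..n} else 0)
      \<partial>count_space UNIV) = 1"
    using total_pos by simp
qed

lemma set_pmf_greedy_hider: "set_pmf greedy_hider = {j \<in> {1..n}. marginal f j \<noteq> 0}"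
  using total_pos by (auto simp: set_pmf_eq pmf_greedy_hider)

lemma greedy_hider_mixed: "greedy_hider \<in> hider_mixed n"
  by (auto simp: hider_mixed_def set_pmf_greedy_hider)

text \<open>Indexed by search position, \<open>a i\<close> is the marginal of the \<open>i\<close>th
  location searched. Its payoff is \<open>f\<close> of the first \<open>i\<close> locations
  searched, hence at least the \<open>i\<close>th prefix sum of \<open>a\<close>. The prefix sum
  inequality then gives half of the total.\<close>

lemma greedy_hider_pure:
  assumes "\<pi> permutes {1..n}"
  shows "f {1..n} / 2 \<le> (\<Sum>j=1..n. pmf greedy_hider j * payoff f j \<pi>)"
proof -
  let ?F = "f {1..n}"
  define a where "a i = real (marginal f (\<pi> i))" for i
  have inj: "inj \<pi>" using assms permutes_inj by blast
  have "(\<Sum>i=1..n. a i) = (\<Sum>j=1..n. real (marginal f j))"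
    unfolding a_def by (rule sum.permute[OF assms, symmetric, unfolded comp_def])
  also have "\<dots> = ?F"
    using n_pos by (subst sum_marginal) (auto simp: of_nat_prefix_value)
  finally have sum_a: "(\<Sum>i=1..n. a i) = ?F" .
  have prefix: "(\<Sum>k=1..i. a k) \<le> f (\<pi> ` {1..i})" if "i \<in> {1..n}" for i
  proof -
    have "\<pi> ` {1..i} \<subseteq> \<pi> ` {1..n}" using that by (intro image_mono) auto
    then have sub: "\<pi> ` {1..i} \<subseteq> {1..n}" by (simp only: permutes_image[OF assms])
    have "(\<Sum>k=1..i. a k) = (\<Sum>j\<in>\<pi> ` {1..i}. real (marginal f j))"
      unfolding a_def using inj by (subst sum.reindex) (auto intro: inj_on_subset)
    also have "\<dots> \<le> f (\<pi> ` {1..i})"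
      using sum_marginal_le[OF sub] that by auto
    finally show ?thesis .
  qed
  have "?F\<^sup>2 \<le> 2 * (\<Sum>i=1..n. a i * (\<Sum>k=1..i. a k))"
    using square_sum_le_prefix_sums[of a n] unfolding sum_a .
  also have "(\<Sum>i=1..n. a i * (\<Sum>k=1..i. a k)) \<le> (\<Sum>i=1..n. a i * f (\<pi> ` {1..i}))"
    using prefix by (intro sum_mono mult_left_mono) (auto simp: a_def)
  finally have *: "?F\<^sup>2 / (2 * ?F) \<le> (\<Sum>i=1..n. a i * f (\<pi> ` {1..i})) / ?F"
    using total_pos by (simp add: divide_simps)
  have "(\<Sum>j=1..n. pmf greedy_hider j * payoff f j \<pi>)
      = (\<Sum>i=1..n. pmf greedy_hider (\<pi> i) * payoff f (\<pi> i) \<pi>)"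
    by (rule sum.permute[OF assms, unfolded comp_def])
  also have "\<dots> = (\<Sum>i=1..n. a i * f (\<pi> ` {1..i}) / ?F)"
    using permutes_in_image[OF assms] inv_f_f[OF inj]
    by (intro sum.cong) (auto simp: pmf_greedy_hider a_def payoff_def)
  also have "\<dots> = (\<Sum>i=1..n. a i * f (\<pi> ` {1..i})) / ?F"
    by (simp add: sum_divide_distrib)
  finally show ?thesis
    using * total_pos by (simp add: power2_eq_square)
qed

lemma greedy_hider_guarantee:
  assumes "y \<in> searcher_mixed n"
  shows "f {1..n} / 2 \<le> expected_payoff f greedy_hider y"
proof -
  let ?S = "{\<pi>. \<pi> permutes {1..n}}"
  have "f {1..n} / 2 = (\<Sum>\<pi>\<in>?S. pmf y \<pi> * (f {1..n} / 2))"
    unfolding sum_distrib_right[symmetric] sum_pmf_searcher[OF assms] by simp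
  also have "\<dots> \<le> expected_payoff f greedy_hider y"
    unfolding expected_payoff_eq_sum[OF greedy_hider_mixed assms]
    by (intro sum_mono mult_left_mono greedy_hider_pure) auto
  finally show ?thesis .
qed

section \<open>Bounds on the value and 2-optimality\<close>

lemma return_id_searcher_mixed: "return_pmf id \<in> searcher_mixed n"
  by (simp add: searcher_mixed_def permutes_id)

text \<open>The identity is one competitor in the infimum; non-negative payoffs supply the lower
  bound that an infimum of reals requires.\<close>

lemma INF_expected_payoff_le:
  assumes "x \<in> hider_mixed n"
  shows "(INF y\<in>searcher_mixed n. expected_payoff f x y) \<le> f {1..n}"
  using assms return_id_searcher_mixed
  by (intro cINF_lower2[where x = "return_pmf id"] bdd_belowI2[where m = 0] expected_payoff_bounds)

lemma game_value_le: "game_value n f \<le> f {1..n}"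
  unfolding game_value_def
  using greedy_hider_mixed by (intro cSUP_least INF_expected_payoff_le) auto

lemma game_value_ge: "f {1..n} / 2 \<le> game_value n f"
  unfolding game_value_def
proof (rule cSUP_upper2)
  show "greedy_hider \<in> hider_mixed n" by (rule greedy_hider_mixed)
  show "f {1..n} / 2 \<le> (INF y\<in>searcher_mixed n. expected_payoff f greedy_hider y)"
    using return_id_searcher_mixed by (intro cINF_greatest greedy_hider_guarantee) auto
  show "bdd_above ((\<lambda>x. INF y\<in>searcher_mixed n. expected_payoff f x y) ` hider_mixed n)"
    by (rule bdd_aboveI2) (rule INF_expected_payoff_le)
qed

lemma hider_optimal_greedy: "hider_optimal 2 n f greedy_hider"
  unfolding hider_optimal_def
proof (intro conjI ballI greedy_hider_mixed)
  fix y assume "y \<in> searcher_mixed n"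
  with greedy_hider_guarantee game_value_le
  show "game_value n f / 2 \<le> expected_payoff f greedy_hider y" by fastforce
qed

text \<open>No strategy costs more than \<open>f {1..n}\<close>, which is at most twice the
  value.\<close>

lemma searcher_optimal_any: "y \<in> searcher_mixed n \<Longrightarrow> searcher_optimal 2 n f y"
  unfolding searcher_optimal_def using expected_payoff_bounds(2) game_value_ge by fastforce

section \<open>Sparse forms of the two strategies\<close>

lemma hider_output_greedy:
  "hider_output greedy_hider
     (concat (map (\<lambda>j. [j, marginal f j, value_oracle f {1..n}])
        (filter (\<lambda>j. marginal f j \<noteq> 0) [1..<Suc n])))"
  unfolding hider_output_def
proof (intro exI conjI)
  \<comment> \<open>Zero marginals are filtered out because the entries must list exactly the
    support. All entries share one denominator.\<close>
  let ?es = "map (\<lambda>j. (j, marginal f j, value_oracle f {1..n}))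
    (filter (\<lambda>j. marginal f j \<noteq> 0) [1..<Suc n])"
  show "sparse_form ?es greedy_hider"
    using total_pos of_nat_total
    by (auto simp: sparse_form_def comp_def set_pmf_greedy_hider pmf_greedy_hider image_iff
             simp del: upt_Suc)
qed (simp add: comp_def del: upt_Suc)

end

lemma searcher_output_id: "searcher_output n (return_pmf id) ([1..<Suc n] @ [1, 1])"
  unfolding searcher_output_def
  by (rule exI[where x = "[(id, 1, 1)]"]) (simp add: sparse_form_def)


section \<open>Step counting\<close>

text \<open>Tracking only an upper bound on the time allows a uniform price for all
  instructions.\<close>

definition halts_within ::
  "instr list \<Rightarrow> (nat set \<Rightarrow> nat) \<Rightarrow> (nat set \<Rightarrow> nat) \<Rightarrow> config \<Rightarrow> nat list \<Rightarrow> nat \<Rightarrow> bool" where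
  "halts_within P \<phi> \<tau> c w B \<longleftrightarrow> (\<exists>t\<le>B. run P \<phi> \<tau> c w t)"

lemma halts_within_mono: "halts_within P \<phi> \<tau> c w B \<Longrightarrow> B \<le> B' \<Longrightarrow> halts_within P \<phi> \<tau> c w B'"
  unfolding halts_within_def using le_trans by blast

lemma halts_within_halt: "length P \<le> pc \<Longrightarrow> halts_within P \<phi> \<tau> (pc, m, out) out B"
  unfolding halts_within_def using run.halt by blast

text \<open>Here \<open>K\<close> is the price of one instruction and \<open>s\<close> the number of
  steps left to pay for.\<close>

lemma halts_within_step:
  assumes "pc < length P" "cost \<phi> \<tau> (P ! pc) m \<le> K"
    and "halts_within P \<phi> \<tau> (exec \<phi> (P ! pc) (pc, m, out)) w (K * s)"
  shows "halts_within P \<phi> \<tau> (pc, m, out) w (K * Suc s)"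
proof -
  obtain t where "t \<le> K * s" "run P \<phi> \<tau> (exec \<phi> (P ! pc) (pc, m, out)) w t"
    using assms(3) by (auto simp: halts_within_def)
  then show ?thesis
    using run.step[OF assms(1)] assms(2) unfolding halts_within_def
    by (intro exI[where x = "cost \<phi> \<tau> (P ! pc) m + t"]) auto
qed

fun operands :: "instr \<Rightarrow> nat set" where
  "operands (Const r k) = {r, k}"
| "operands (Add r s t) = {r, s, t}"
| "operands (Sub r s t) = {r, s, t}"
| "operands (Load r s) = {r, s}"
| "operands (Store r s) = {r, s}"
| "operands (Jump l) = {l}"
| "operands (JumpZero r l) = {r, l}"
| "operands (Query r s) = {r, s}"
| "operands (Write r) = {r}"

lemma len_mono: "x \<le> y \<Longrightarrow> len x \<le> len y"
  by (simp add: len_def floorlog_mono)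

lemma len_operand: "x < 32 \<Longrightarrow> len x \<le> 6"
  using floorlog_leI[of x 2 5] by (simp add: len_def)

text \<open>An instruction handles at most three operands of length at most 6 and two numbers
  bounded by \<open>M\<close>. For \<open>Query\<close> the answer is one of these numbers, and
  \<open>T\<close> pays for the oracle.\<close>

lemma cost_le:
  assumes "\<forall>x\<in>operands i. x < 32" "\<forall>r. m r \<le> M"
    and "\<forall>r s. i = Query r s \<longrightarrow> \<phi> (set_decode (m s)) \<le> M \<and> \<tau> (set_decode (m s)) \<le> T"
  shows "cost \<phi> \<tau> i m \<le> 18 + 2 * len M + T"
proof -
  have op: "len x \<le> 6" if "x \<in> operands i" for x
    using that assms(1) len_operand by blast
  have mem: "len (m r) \<le> len M" for r
    using assms(2) len_mono by blast
  show ?thesis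
  proof (cases i)
    case (Const r k)
    then show ?thesis using op[of r] op[of k] by simp
  next
    case (Add r s t)
    then show ?thesis using op[of r] op[of s] op[of t] mem[of s] mem[of t] by simp
  next
    case (Sub r s t)
    then show ?thesis using op[of r] op[of s] op[of t] mem[of s] mem[of t] by simp
  next
    case (Load r s)
    then show ?thesis using op[of r] op[of s] mem[of s] mem[of "m s"] by simp
  next
    case (Store r s)
    then show ?thesis using op[of r] op[of s] mem[of r] mem[of s] by simp
  next
    case (Jump l)
    then show ?thesis using op[of l] by simp
  next
    case (JumpZero r l)
    then show ?thesis using op[of r] op[of l] mem[of r] by simp
  next
    case (Query r s)
    have "len (\<phi> (set_decode (m s))) \<le> len M" "\<tau> (set_decode (m s)) \<le> T"
      using assms(3) Query by (simp_all add: len_mono)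
    then show ?thesis using op[of r] op[of s] mem[of s] Query by simp
  next
    case (Write r)
    then show ?thesis using op[of r] mem[of r] by simp
  qed
qed

text \<open>The product bounds query masks (below \<open>2 ^ (n + 1)\<close>) as well as oracle values, and its
  length is the sum of theirs.\<close>

definition register_bound :: "nat \<Rightarrow> (nat set \<Rightarrow> real) \<Rightarrow> nat" where
  "register_bound n f = value_oracle f {1..n} * 2 ^ (n + 1)"

text \<open>18 pays for three operands of length at most 6, that is, program addresses and registers
  below 32.\<close>

abbreviation step_cost :: "nat \<Rightarrow> (nat set \<Rightarrow> real) \<Rightarrow> nat \<Rightarrow> nat" where
  "step_cost n f T \<equiv> 18 + 2 * len (register_bound n f) + T"

text \<open>The logarithm of the product is \<open>log 2 (f {1..n}) + n + 1\<close>, and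
  \<open>len\<close> adds at most 2.\<close>

lemma len_register_bound:
  assumes "sub_instance n f"
  shows "real (len (register_bound n f)) \<le> real n + log 2 (f {1..n}) + 3"
proof -
  let ?F = "value_oracle f {1..n}"
  have F: "real ?F = f {1..n}" "?F > 0"
    using of_nat_total[OF assms] value_oracle_total_ge_1[OF assms] by auto
  then have "log 2 (real (register_bound n f)) = log 2 (f {1..n}) + (real n + 1)"
    by (simp add: register_bound_def log_mult log_nat_power)
  moreover have "1 \<le> register_bound n f"
    using F(2) by (simp add: register_bound_def)
  then have "real (nat \<lfloor>log 2 (real (register_bound n f))\<rfloor>) \<le> log 2 (real (register_bound n f))"
    by (intro of_nat_floor) simp
  moreover have "real (len (register_bound n f)) \<le>
      2 + real (nat \<lfloor>log 2 (real (register_bound n f))\<rfloor>)"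
    by (simp add: len_def floorlog_def)
  ultimately show ?thesis
    by linarith
qed

text \<open>A budget of \<open>k * n\<close> uniformly priced steps is polynomial. A step costs at
  most \<open>(26 + a) * X ^ (b + 1)\<close> and \<open>n \<le> X\<close>, whence the coefficient
  \<open>(26 + a) * k\<close> and the exponent \<open>b + 2\<close>.\<close>

lemma poly_time_solvesI:
  assumes "\<And>n f \<tau> T. sub_instance n f \<Longrightarrow> (\<And>S. S \<subseteq> {1..n} \<Longrightarrow> \<tau> S \<le> T) \<Longrightarrow>
    \<exists>w. halts_within P (value_oracle f) \<tau> (initial_config n) w (step_cost n f T * (k * n)) \<and> R n f w"
  shows "poly_time_solves P R"
  unfolding poly_time_solves_def
proof (rule allI, rule allI, rule exI, rule exI, intro allI impI)
  fix a b n :: nat and f \<tau>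
  assume inst: "sub_instance n f" and \<tau>: "\<forall>S. S \<subseteq> {1..n} \<longrightarrow> \<tau> S \<le> a * n ^ b"
  define X where "X = real n + log 2 (largest_payoff n f)"
  obtain w t where w: "R n f w" and run: "run P (value_oracle f) \<tau> (initial_config n) w t"
    and t: "t \<le> step_cost n f (a * n ^ b) * (k * n)"
    using assms[OF inst, of \<tau> "a * n ^ b"] \<tau> unfolding halts_within_def by blast
  have "1 \<le> f {1..n}"
    using value_oracle_total_ge_1[OF inst] unfolding of_nat_total[OF inst, symmetric] by simp
  then have X: "1 \<le> X" "real n \<le> X"
    using n_pos[OF inst] by (auto simp: X_def largest_payoff_eq[OF inst] add_increasing2)
  have pow: "X \<le> X ^ Suc b"
    using X(1) by (simp add: mult_le_cancel_left1 one_le_power)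
  \<comment> \<open>The 26 arises from \<open>18 + 2 * (X + 3) = 24 + 2 * X\<close> and
    \<open>1 \<le> X\<close>.\<close>
  have "real (step_cost n f (a * n ^ b)) \<le> 26 * X + real a * real n ^ b"
    using len_register_bound[OF inst] X(1) by (simp add: X_def largest_payoff_eq[OF inst])
  also have "\<dots> \<le> 26 * X ^ Suc b + real a * X ^ Suc b"
  proof (intro add_mono mult_left_mono pow)
    have "real n ^ b \<le> X ^ b" using X(2) by (intro power_mono) auto
    also have "\<dots> \<le> X ^ Suc b" using X(1) by (intro power_increasing) auto
    finally show "real n ^ b \<le> X ^ Suc b" .
  qed auto
  finally have K: "real (step_cost n f (a * n ^ b)) \<le> (26 + real a) * X ^ Suc b"
    unfolding distrib_right .
  have "real t \<le> real (step_cost n f (a * n ^ b)) * (real k * real n)"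
    using t unfolding of_nat_mult[symmetric] of_nat_le_iff .
  also have "\<dots> \<le> ((26 + real a) * X ^ Suc b) * (real k * X)"
    using X by (intro mult_mono K mult_left_mono) auto
  also have "\<dots> = real ((26 + a) * k) * X ^ (b + 2)"
    by simp
  finally show "\<exists>w t. run P (value_oracle f) \<tau> (initial_config n) w t \<and> R n f w \<and>
      real t \<le> real ((26 + a) * k) * (real n + log 2 (largest_payoff n f)) ^ (b + 2)"
    using run w unfolding X_def by blast
qed

section \<open>Binary masks of prefixes\<close>

lemma set_encode_prefix: "set_encode {1..i} + 2 = 2 ^ (i + 1)"
proof (induction i)
  case (Suc i)
  have "{1..Suc i} = insert (Suc i) {1..i}" by auto
  then have "set_encode {1..Suc i} = 2 ^ Suc i + set_encode {1..i}"
    using set_encode_insert[of "{1..i}" "Suc i"] by (simp del: One_nat_def set_encode_insert)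
  with Suc show ?case unfolding Suc_eq_plus1[symmetric] power_Suc by linarith
qed simp

text \<open>Bit 0 is always clear, so doubling shifts the block of ones and adding 2 refills bit 1.
  The form matches the machine's two additions.\<close>

lemma set_encode_prefix_Suc: "set_encode {1..Suc i} = set_encode {1..i} + set_encode {1..i} + 2"
  using set_encode_prefix[of i] set_encode_prefix[of "Suc i"] by simp

section \<open>The machines\<close>

text \<open>Register 0 holds \<open>n\<close>, register 3 counts the locations written, and register
  2 receives the number that remain. The final two writes give the identity probability
  \<open>1 / 1\<close>.\<close>

definition searcher_prog :: "instr list" where
  "searcher_prog =
    [Const 1 1,
     Sub 2 0 3,
     JumpZero 2 6,
     Add 3 3 1,
     Write 3,
     Jump 1,
     Write 1,
     Write 1]"

text \<open>Register 3 holds the mask of \<open>{1..j}\<close>, which \<open>x \<mapsto> x + x + 2\<close> advances, register 5 holds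
  \<open>f {1..n}\<close>, and register 6 holds the prefix value at \<open>j\<close>.  Instructions 3 to 7 compute the mask
  of \<open>{1..n}\<close>, with a counter in register 4; from instruction 10 on, register 4 holds \<open>j\<close>.  Instruction 18
  skips zero marginals, since the output may list only non-zero probabilities.\<close>

definition hider_prog :: "instr list" where
  "hider_prog =
    [Const 1 1,
     Const 2 2,
     Add 4 0 8,
     JumpZero 4 8,
     Add 3 3 3,
     Add 3 3 2,
     Sub 4 4 1,
     Jump 3,
     Query 5 3,
     Const 3 0,
     Sub 7 0 4,
     JumpZero 7 23,
     Add 4 4 1,
     Add 3 3 3,
     Add 3 3 2,
     Query 7 3,
     Sub 8 7 6,
     Add 6 7 9,
     JumpZero 8 10,
     Write 4,
     Write 8,
     Write 5,
     Jump 10]"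

definition bounded_memory :: "nat \<Rightarrow> (nat \<Rightarrow> nat) \<Rightarrow> bool" where
  "bounded_memory M m \<longleftrightarrow> (\<forall>r. m r \<le> M)"

lemma bounded_memory_upd: "bounded_memory M m \<Longrightarrow> x \<le> M \<Longrightarrow> bounded_memory M (m(r := x))"
  by (simp add: bounded_memory_def)

text \<open>What the main loop still has to write once the locations up to \<open>j\<close> are
  done; \<open>j = 0\<close> gives the whole output.\<close>

definition hider_entries :: "nat \<Rightarrow> (nat set \<Rightarrow> real) \<Rightarrow> nat \<Rightarrow> nat list" where
  "hider_entries n f j = concat (map (\<lambda>j. [j, marginal f j, value_oracle f {1..n}])
     (filter (\<lambda>j. marginal f j \<noteq> 0) [Suc j..<Suc n]))"

lemmas searcher_simps = searcher_prog_def bounded_memory_upd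
  and hider_simps = hider_prog_def bounded_memory_upd

section \<open>Loop invariants and step counts of the machines\<close>

context
  fixes n :: nat and f :: "nat set \<Rightarrow> real" and \<tau> :: "nat set \<Rightarrow> nat" and T :: nat
  assumes inst: "sub_instance n f" and \<tau>: "\<And>S. S \<subseteq> {1..n} \<Longrightarrow> \<tau> S \<le> T"
begin

lemma register_bound_ge:
  "i \<le> n \<Longrightarrow> 2 ^ (i + 1) \<le> register_bound n f"
  "value_oracle f {1..n} \<le> register_bound n f"
proof -
  assume "i \<le> n"
  then have "1 * 2 ^ (i + 1) \<le> value_oracle f {1..n} * 2 ^ (n + 1)"
    using value_oracle_total_ge_1[OF inst] by (intro mult_mono power_increasing) auto
  then show "2 ^ (i + 1) \<le> register_bound n f" by (simp add: register_bound_def)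
qed (simp add: register_bound_def)

lemma register_bound_facts:
  "2 \<le> register_bound n f" "i \<le> n \<Longrightarrow> i \<le> register_bound n f"
  "i \<le> n \<Longrightarrow> set_encode {1..i} \<le> register_bound n f"
  "i \<le> n \<Longrightarrow> value_oracle f {1..i} \<le> register_bound n f"
proof -
  show "2 \<le> register_bound n f" using register_bound_ge(1)[of 0] by simp
  show "i \<le> register_bound n f" if "i \<le> n"
    using register_bound_ge(1)[OF that] less_exp[of "i + 1"] by linarith
  show "set_encode {1..i} \<le> register_bound n f" if "i \<le> n"
    using register_bound_ge(1)[OF that] set_encode_prefix[of i] by linarith
  show "value_oracle f {1..i} \<le> register_bound n f" if "i \<le> n"
    using register_bound_ge(2) value_oracle_le_total[OF inst, of "{1..i}"] that by auto
qed

definition halts :: "instr list \<Rightarrow> config \<Rightarrow> nat list \<Rightarrow> nat \<Rightarrow> bool" where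
  "halts P c w s \<longleftrightarrow> halts_within P (value_oracle f) \<tau> c w (step_cost n f T * s)"

lemma halts_halt: "length P \<le> pc \<Longrightarrow> w = out \<Longrightarrow> halts P (pc, m, out) w s"
  by (simp add: halts_def halts_within_halt)

lemma halts_mono: "halts P c w s \<Longrightarrow> s \<le> s' \<Longrightarrow> halts P c w s'"
  unfolding halts_def by (erule halts_within_mono) (rule mult_le_mono2)

text \<open>One step of symbolic execution: the last premise is the same goal one step later.
  Queries must stay inside \<open>{1..n}\<close>, where both the answer and the oracle time are
  bounded.\<close>

lemma halts_step:
  assumes "pc < length P" "P ! pc = i" "\<forall>x\<in>operands i. x < 32" "bounded_memory (register_bound n f) m"
    and "\<forall>r s. i = Query r s \<longrightarrow> set_decode (m s) \<subseteq> {1..n}"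
    and "exec (value_oracle f) i (pc, m, out) = c" "0 < s"
    and "halts P c w (s - 1)"
  shows "halts P (pc, m, out) w s"
proof -
  have cost: "cost (value_oracle f) \<tau> (P ! pc) m \<le> step_cost n f T"
    unfolding assms(2)
  proof (rule cost_le[OF assms(3)])
    show "\<forall>r. m r \<le> register_bound n f"
      using assms(4) unfolding bounded_memory_def .
    show "\<forall>r s. i = Query r s \<longrightarrow>
        value_oracle f (set_decode (m s)) \<le> register_bound n f \<and> \<tau> (set_decode (m s)) \<le> T"
    proof (intro allI impI)
      fix r s assume "i = Query r s"
      then have S: "set_decode (m s) \<subseteq> {1..n}" using assms(5) by simp
      show "value_oracle f (set_decode (m s)) \<le> register_bound n f \<and> \<tau> (set_decode (m s)) \<le> T"
        using value_oracle_le_total[OF inst S] register_bound_ge(2) \<tau>[OF S] by simp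
    qed
  qed
  have "halts P (pc, m, out) w (Suc (s - 1))"
    unfolding halts_def
  proof (rule halts_within_step[OF assms(1) cost])
    show "halts_within P (value_oracle f) \<tau> (exec (value_oracle f) (P ! pc) (pc, m, out)) w
        (step_cost n f T * (s - 1))"
      using assms(8) unfolding halts_def assms(2,6) .
  qed
  then show ?thesis using assms(7) by simp
qed

text \<open>Each location takes 5 instructions; the exit takes the failing test and the two final
  writes, 4 in all.\<close>

lemma searcher_loop:
  assumes "m 0 = n" "m 1 = 1" "m 3 = j" "j \<le> n" "bounded_memory (register_bound n f) m"
  shows "halts searcher_prog (1, m, out) (out @ [Suc j..<Suc n] @ [1, 1]) (5 * (n - j) + 4)"
  using assms
proof (induction "n - j" arbitrary: j m out)
  case 0
  then show ?case
    using register_bound_facts(1)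
    apply -
    apply (rule halts_step, (simp add: searcher_simps; fail)+)
    apply (rule halts_step, (simp add: searcher_simps; fail)+)
    apply (rule halts_step, (simp add: searcher_simps; fail)+)
    apply (rule halts_step, (simp add: searcher_simps; fail)+)
    apply (rule halts_halt, simp_all add: searcher_prog_def)
    done
next
  case (Suc k)
  have *: "[Suc j..<Suc n] = Suc j # [Suc (Suc j)..<Suc n]"
    using Suc.hyps(2) by (intro upt_conv_Cons) simp
  have "Suc j \<le> n" using Suc.hyps(2) by simp
  then show ?case
    unfolding * append_Cons using Suc.prems register_bound_facts(1) register_bound_facts(2)[of "Suc j"]
      register_bound_facts(2)[of "n - j"]
    apply -
    apply (rule halts_step, (simp add: searcher_simps; fail)+)
    apply (rule halts_step, (simp add: searcher_simps; fail)+)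
    apply (rule halts_step, (simp add: searcher_simps; fail)+)
    apply (rule halts_step, (simp add: searcher_simps; fail)+)
    apply (rule halts_step, (simp add: searcher_simps; fail)+)
    apply (fold One_nat_def)
    apply (rule halts_mono)
    apply (rule Suc.hyps(1)[of "Suc j" _ "out @ [Suc j]", unfolded append.simps append_assoc])
    using Suc.hyps(2) apply (simp_all add: bounded_memory_upd)
    done
qed

text \<open>The premise \<open>cont\<close> stands for the rest of the run, which takes
  \<open>s\<close> steps. Each round takes 5 instructions and the exit 1. Register 9 stays 0, so
  that the main loop can copy by adding it.\<close>

lemma hider_mask_loop:
  assumes "m 0 = n" "m 1 = 1" "m 2 = 2" "m 3 = set_encode {1..j}" "m 4 = n - j" "j \<le> n"
    "m 6 = 0" "m 9 = 0" "bounded_memory (register_bound n f) m"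
    and cont: "\<And>m'. m' 0 = n \<Longrightarrow> m' 1 = 1 \<Longrightarrow> m' 2 = 2 \<Longrightarrow> m' 3 = set_encode {1..n} \<Longrightarrow>
      m' 4 = 0 \<Longrightarrow> m' 6 = 0 \<Longrightarrow> m' 9 = 0 \<Longrightarrow> bounded_memory (register_bound n f) m' \<Longrightarrow>
      halts hider_prog (8, m', out) w s"
  shows "halts hider_prog (3, m, out) w (s + 5 * (n - j) + 1)"
  using assms(1-9)
proof (induction "n - j" arbitrary: j m)
  case 0
  then have "halts hider_prog (8, m, out) w s" by (intro cont) simp_all
  with 0 show ?case
    apply -
    apply (rule halts_step, (simp add: hider_simps; fail)+)
    done
next
  case (Suc k)
  define c c' where "c = set_encode {1..j}" and "c' = set_encode {1..Suc j}"
  have c': "c + c + 2 = c'"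
    by (simp only: c_def c'_def set_encode_prefix_Suc)
  have j: "j < n" "n - Suc j = n - j - 1" using Suc.hyps(2) by simp_all
  have "c' \<le> register_bound n f"
    unfolding c'_def using j by (intro register_bound_facts(3)) simp
  moreover have "n - j - 1 \<le> register_bound n f"
    by (rule register_bound_facts(2)) simp
  \<comment> \<open>Register 3 holds the doubled mask between the two additions, so this number
    needs a bound as well.\<close>
  moreover have "c + c \<le> c'" using c' by simp
  moreover note Suc.prems[folded c_def] j(1) c'
  ultimately show ?case
    apply -
    apply (rule halts_step, (simp add: hider_simps; fail)+)
    apply (rule halts_step, (simp add: hider_simps; fail)+)
    apply (rule halts_step, (simp add: hider_simps; fail)+)
    apply (rule halts_step, (simp add: hider_simps; fail)+)
    apply (rule halts_step, (simp add: hider_simps; fail)+)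
    apply (rule halts_mono)
    apply (rule Suc.hyps(1)[of "Suc j", folded c'_def])
    using Suc.hyps(2) apply (simp_all add: bounded_memory_upd)
    done
qed

text \<open>A location takes 13 instructions if an entry is written and 9 if its marginal is zero;
  the exit takes 2.\<close>

lemma hider_main_loop:
  assumes "m 0 = n" "m 1 = 1" "m 2 = 2" "m 3 = set_encode {1..j}" "m 4 = j" "j \<le> n"
    "m 5 = value_oracle f {1..n}" "m 6 = prefix_value f j" "m 9 = 0"
    "bounded_memory (register_bound n f) m"
  shows "halts hider_prog (10, m, out) (out @ hider_entries n f j) (13 * (n - j) + 2)"
  using assms
proof (induction "n - j" arbitrary: j m out)
  case 0
  then show ?case
    apply -
    apply (rule halts_step, (simp add: hider_simps; fail)+)
    apply (rule halts_step, (simp add: hider_simps; fail)+)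
    apply (rule halts_halt)
    apply (simp_all add: hider_prog_def hider_entries_def)
    done
next
  case (Suc k)
  define c c' where "c = set_encode {1..j}" and "c' = set_encode {1..Suc j}"
  define F where "F = value_oracle f {1..n}"
  define u v where "u = prefix_value f j" and "v = prefix_value f (Suc j)"
  have c': "c + c + 2 = c'"
    by (simp only: c_def c'_def set_encode_prefix_Suc)
  have j: "j < n" using Suc.hyps(2) by simp
  have v: "value_oracle f (set_decode c') = v"
    unfolding c'_def v_def prefix_value_def by simp
  \<comment> \<open>The subtraction is the machine's own, so register 8 holds the marginal.\<close>
  have marginal: "marginal f (Suc j) = v - u"
    by (simp add: marginal_def u_def v_def)
  have dec: "set_decode c' \<subseteq> {1..n}" unfolding c'_def using j by simp
  have b: "c' \<le> register_bound n f" "v \<le> register_bound n f" "Suc j \<le> register_bound n f"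
    "n - j \<le> register_bound n f"
    unfolding c'_def v[symmetric]
    using j register_bound_facts(2)[of "Suc j"] register_bound_facts(2)[of "n - j"]
      register_bound_facts(3)[of "Suc j"] register_bound_facts(4)[of "Suc j"]
    by simp_all
  have IH: "halts hider_prog (10, m', out') (out' @ hider_entries n f (Suc j)) (13 * (n - Suc j) + 2)"
    if "m' 0 = n" "m' 1 = 1" "m' 2 = 2" "m' 3 = c'" "m' 4 = Suc j"
      "m' 5 = F" "m' 6 = v" "m' 9 = 0"
      "bounded_memory (register_bound n f) m'" for m' out'
    using Suc.hyps(2) that unfolding c'_def v_def F_def by (intro Suc.hyps(1)) simp_all
  have "[Suc j..<Suc n] = Suc j # [Suc (Suc j)..<Suc n]"
    using j by (intro upt_conv_Cons) simp
  then have entries: "hider_entries n f j =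
      (if v - u = 0 then [] else [Suc j, v - u, F]) @ hider_entries n f (Suc j)"
    by (simp add: hider_entries_def marginal F_def del: upt_Suc)
  have "c + c \<le> c'" using c' by simp
  note facts = this Suc.prems[folded c_def u_def F_def] j c' v dec b
  show ?case
  proof (cases "v - u = 0")
    case True
    then have eq: "out @ hider_entries n f j = out @ hider_entries n f (Suc j)"
      by (simp add: entries)
    show ?thesis
      unfolding eq using True facts
      apply -
    apply (rule halts_step, (simp add: hider_simps; fail)+)
    apply (rule halts_step, (simp add: hider_simps; fail)+)
    apply (rule halts_step, (simp add: hider_simps; fail)+)
    apply (rule halts_step, (simp add: hider_simps; fail)+)
    apply (rule halts_step, (simp add: hider_simps; fail)+)
    apply (rule halts_step, (simp add: hider_simps; fail)+)
    apply (rule halts_step, (simp add: hider_simps; fail)+)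
    apply (rule halts_step, (simp add: hider_simps; fail)+)
    apply (rule halts_step, (simp add: hider_simps; fail)+)
      apply (rule halts_mono)
      apply (rule IH)
      apply (simp_all add: bounded_memory_upd)
      done
  next
    case False
    then have eq: "out @ hider_entries n f j =
        (out @ [Suc j, v - u, F]) @ hider_entries n f (Suc j)"
      by (simp add: entries)
    show ?thesis
      unfolding eq using False facts
      apply -
    apply (rule halts_step, (simp add: hider_simps; fail)+)
    apply (rule halts_step, (simp add: hider_simps; fail)+)
    apply (rule halts_step, (simp add: hider_simps; fail)+)
    apply (rule halts_step, (simp add: hider_simps; fail)+)
    apply (rule halts_step, (simp add: hider_simps; fail)+)
    apply (rule halts_step, (simp add: hider_simps; fail)+)
    apply (rule halts_step, (simp add: hider_simps; fail)+)
    apply (rule halts_step, (simp add: hider_simps; fail)+)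
    apply (rule halts_step, (simp add: hider_simps; fail)+)
    apply (rule halts_step, (simp add: hider_simps; fail)+)
    apply (rule halts_step, (simp add: hider_simps; fail)+)
    apply (rule halts_step, (simp add: hider_simps; fail)+)
    apply (rule halts_step, (simp add: hider_simps; fail)+)
      apply (rule halts_mono)
      apply (rule IH)
      apply (simp_all add: bounded_memory_upd)
      done
  qed
qed

lemma bounded_memory_initial: "bounded_memory (register_bound n f) ((\<lambda>_. 0)(0 := n))"
  using register_bound_facts(2)[of n] by (simp add: bounded_memory_def)

lemma searcher_prog_halts:
  "halts_within searcher_prog (value_oracle f) \<tau> (initial_config n) ([1..<Suc n] @ [1, 1])
     (step_cost n f T * (26 * n))"
  unfolding initial_config_def halts_def[symmetric]
  using bounded_memory_initial register_bound_facts(1) n_pos[OF inst]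
  apply -
  apply (rule halts_step, (simp add: searcher_simps; fail)+)
  apply (rule halts_mono)
  apply (fold One_nat_def)
  apply (rule searcher_loop[of _ 0 "[]", unfolded append_Nil, folded One_nat_def])
  apply (simp_all add: bounded_memory_upd)
  done

text \<open>There are 3 instructions of setup, \<open>5 * n + 1\<close> for the mask, 2 in between
  and \<open>13 * n + 2\<close> for the main loop. The sum \<open>18 * n + 8\<close> is at most
  \<open>26 * n\<close> as \<open>n \<ge> 1\<close>.\<close>

lemma hider_prog_halts:
  "halts_within hider_prog (value_oracle f) \<tau> (initial_config n) (hider_entries n f 0)
     (step_cost n f T * (26 * n))"
proof -
  have loops: "halts hider_prog (3, m, []) (hider_entries n f 0)
      ((13 * (n - 0) + 2 + 2) + 5 * (n - 0) + 1)"
    if "m 0 = n" "m 1 = 1" "m 2 = 2" "m 3 = set_encode {1..0}" "m 4 = n - 0" "0 \<le> n"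
      "m 6 = 0" "m 9 = 0" "bounded_memory (register_bound n f) m" for m
  proof (rule hider_mask_loop[OF that])
    fix m' :: "nat \<Rightarrow> nat"
    define c F where "c = set_encode {1..n}" and "F = value_oracle f {1..n}"
    assume m': "m' 0 = n" "m' 1 = 1" "m' 2 = 2" "m' 3 = set_encode {1..n}" "m' 4 = 0"
      "m' 6 = 0" "m' 9 = 0" "bounded_memory (register_bound n f) m'"
    have c: "value_oracle f (set_decode c) = F" "set_decode c \<subseteq> {1..n}" "F \<le> register_bound n f"
      using register_bound_ge(2) by (simp_all add: c_def F_def)
    \<comment> \<open>The mask 0 and the prefix value 0 are the invariant at
      \<open>j = 0\<close>.\<close>
    have main: "halts hider_prog (10, m'', []) (hider_entries n f 0) (13 * (n - 0) + 2)"
      if "m'' 0 = n" "m'' 1 = 1" "m'' 2 = 2" "m'' 3 = 0" "m'' 4 = 0" "m'' 5 = F" "m'' 6 = 0"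
        "m'' 9 = 0" "bounded_memory (register_bound n f) m''" for m''
      using hider_main_loop[of m'' 0 "[]"] that by (simp add: prefix_value_def F_def)
    show "halts hider_prog (8, m', []) (hider_entries n f 0) (13 * (n - 0) + 2 + 2)"
      using m'[folded c_def] c
      apply -
      apply (rule halts_step, (simp add: hider_simps; fail)+)
      apply (rule halts_step, (simp add: hider_simps; fail)+)
      apply (rule halts_mono)
      apply (rule main)
      apply (simp_all add: bounded_memory_upd)
      done
  qed
  show ?thesis
    unfolding initial_config_def halts_def[symmetric]
    using bounded_memory_initial register_bound_facts(1) register_bound_facts(2)[of n] n_pos[OF inst]
    apply -
    apply (rule halts_step, (simp add: hider_simps; fail)+)
    apply (rule halts_step, (simp add: hider_simps; fail)+)
    apply (rule halts_step, (simp add: hider_simps; fail)+)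
    apply (fold numeral_3_eq_3)
    apply (rule halts_mono)
    apply (rule loops)
    apply (simp_all add: bounded_memory_upd)
    done
qed

end

theorem theorem4:
  "(\<exists>P. poly_time_solves P (\<lambda>n f w. \<exists>x. hider_optimal 2 n f x \<and> hider_output x w)) \<and>
   (\<exists>Q. poly_time_solves Q (\<lambda>n f w. \<exists>y. searcher_optimal 2 n f y \<and> searcher_output n y w))"
proof (intro conjI exI)
  show "poly_time_solves hider_prog (\<lambda>n f w. \<exists>x. hider_optimal 2 n f x \<and> hider_output x w)"
  proof (rule poly_time_solvesI[where k = 26], intro exI conjI)
    fix n T :: nat and f \<tau>
    assume *: "sub_instance n f" "\<And>S. S \<subseteq> {1..n} \<Longrightarrow> \<tau> S \<le> T"
    show "halts_within hider_prog (value_oracle f) \<tau> (initial_config n) (hider_entries n f 0)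
        (step_cost n f T * (26 * n))"
      by (intro hider_prog_halts *)
    show "hider_optimal 2 n f (greedy_hider n f)" by (rule hider_optimal_greedy[OF *(1)])
    show "hider_output (greedy_hider n f) (hider_entries n f 0)"
      using hider_output_greedy[OF *(1)] unfolding hider_entries_def One_nat_def .
  qed
  show "poly_time_solves searcher_prog (\<lambda>n f w. \<exists>y. searcher_optimal 2 n f y \<and> searcher_output n y w)"
  proof (rule poly_time_solvesI[where k = 26], intro exI conjI)
    fix n T :: nat and f \<tau>
    assume *: "sub_instance n f" "\<And>S. S \<subseteq> {1..n} \<Longrightarrow> \<tau> S \<le> T"
    show "halts_within searcher_prog (value_oracle f) \<tau> (initial_config n) ([1..<Suc n] @ [1, 1])
        (step_cost n f T * (26 * n))"
      by (intro searcher_prog_halts *)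
    show "searcher_optimal 2 n f (return_pmf id)"
      by (rule searcher_optimal_any[OF *(1) return_id_searcher_mixed[OF *(1)]])
    show "searcher_output n (return_pmf id) ([1..<Suc n] @ [1, 1])" by (rule searcher_output_id)
  qed
qed

end
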